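(* Let $P,Q$ be polygonal curves in $(\mathbb{R}^d,\|\cdot\|)$, where $\|\cdot\|$ is any norm, let $C$ be a parameter space cell of $P,Q$, and let $x,y\in C$ be two points with $x\preceq y$. Consider the $(x,y)$-path $\gamma_{xy}$ tracing line segments from $x$ to $(x_1,y_2)^{\mathsf T}$ to $y$, and the $(x,y)$-path $\gamma_{yx}$ tracing line segments from $x$ to $(y_1,x_2)^{\mathsf T}$ to $y$. Their costs under $\|\cdot\|$ satisfy $$\tfrac15\cdot\mathrm{cost}_{\|\cdot\|}(\gamma_{xy})\le\mathrm{cost}_{\|\cdot\|}(\gamma_{yx})\le 5\cdot\mathrm{cost}_{\|\cdot\|}(\gamma_{xy}).$$
   Context: A polygonal curve $P=\langle p_0,\dots,p_n\rangle$ in $(\mathbb{R}^d,\|\cdot\|)$ consists of the $n\ge1$ consecutive segments from $p_{i-1}$ to $p_i$ ($p_i\ne p_{i-1}$); $P_{\le i}:=\langle p_0,\dots,p_i\rangle$; $\|P\|:=\sum_{i=1}^n\|p_i-p_{i-1}\|$ is its arc length; $P_{\|\cdot\|}:[0,\|P\|]\to\mathbb{R}^d$ is its arc length parametrisation with constant speed $1$ under $\|\cdot\|$. The parameter space of $P=\langle p_0,\dots,p_n\rangle$ and $Q=\langle q_0,\dots,q_m\rangle$ is $[0,\|P\|]\times[0,\|Q\|]$; its cells are $C_{i,j}=[\|P_{\le i-1}\|,\|P_{\le i}\|]\times[\|Q_{\le j-1}\|,\|Q_{\le j}\|]$ for $1\le i\le n$, $1\le j\le m$. Write $x\preceq y$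 if $x_1\le y_1$ and $x_2\le y_2$. An $(x,y)$-path is a coordinatewise nondecreasing, piecewise continuously differentiable map $\gamma:[\|x\|_1,\|y\|_1]\to[0,\|P\|]\times[0,\|Q\|]$ from $x$ to $y$ with $\|\gamma'\|_1=1$ (so a path tracing given segments is uniquely determined), and its cost is $$\mathrm{cost}_{\|\cdot\|}(\gamma)=\int_{\|x\|_1}^{\|y\|_1}\bigl\|P_{\|\cdot\|}(\gamma_1(t))-Q_{\|\cdot\|}(\gamma_2(t))\bigr\|\,dt .$$ *)

theory Defs
  imports "HOL-Analysis.Analysis"
begin

text \<open>
  The norm is an arbitrary function \<open>N\<close> satisfying the norm axioms; it is unrelated to the
  Euclidean norm of the type \<open>real ^ 'd\<close>.
\<close>

definition is_norm :: "(real ^ 'd \<Rightarrow> real) \<Rightarrow> bool" where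
  "is_norm N \<longleftrightarrow>
     (\<forall>v. 0 \<le> N v) \<and> (\<forall>v. N v = 0 \<longleftrightarrow> v = 0) \<and>
     (\<forall>c v. N (c *\<^sub>R v) = \<bar>c\<bar> * N v) \<and> (\<forall>v w. N (v + w) \<le> N v + N w)"

text \<open>
  The curve \<open>\<langle>p\<^sub>0, \<dots>, p\<^sub>n\<rangle>\<close> is the list of its \<open>n + 1\<close> vertices, so \<open>n = length P - 1\<close>.
\<close>

definition polygonal_curve :: "(real ^ 'd) list \<Rightarrow> bool" where
  "polygonal_curve P \<longleftrightarrow> 2 \<le> length P \<and> distinct_adj P"

abbreviation curve_upto :: "(real ^ 'd) list \<Rightarrow> nat \<Rightarrow> (real ^ 'd) list" where
  "curve_upto P i \<equiv> take (Suc i) P"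

definition arc_length :: "(real ^ 'd \<Rightarrow> real) \<Rightarrow> (real ^ 'd) list \<Rightarrow> real" where
  "arc_length N P = (\<Sum>i = 1..<length P. N (P ! i - P ! (i - 1)))"

text \<open>
  Arc length parametrisation, relevant only for \<open>0 \<le> t \<le> arc_length N P\<close>; the values elsewhere
  are junk. The closed form on each edge is lemma \<open>arc_param_edge\<close> below.
\<close>

fun arc_param :: "(real ^ 'd \<Rightarrow> real) \<Rightarrow> (real ^ 'd) list \<Rightarrow> real \<Rightarrow> real ^ 'd" where
  "arc_param N (p # q # ps) t =
     (if t \<le> N (q - p) then p + (t / N (q - p)) *\<^sub>R (q - p)
      else arc_param N (q # ps) (t - N (q - p)))"
| "arc_param N [p] t = p"
| "arc_param N [] t = 0"

definition param_space :: "(real ^ 'd \<Rightarrow> real) \<Rightarrow> (real ^ 'd) list \<Rightarrow> (real ^ 'd) list \<Rightarrow> (real \<times> real) set" where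
  "param_space N P Q = {0..arc_length N P} \<times> {0..arc_length N Q}"

definition cell ::
  "(real ^ 'd \<Rightarrow> real) \<Rightarrow> (real ^ 'd) list \<Rightarrow> (real ^ 'd) list \<Rightarrow> nat \<Rightarrow> nat \<Rightarrow> (real \<times> real) set" where
  "cell N P Q i j =
     {arc_length N (curve_upto P (i - 1))..arc_length N (curve_upto P i)} \<times>
     {arc_length N (curve_upto Q (j - 1))..arc_length N (curve_upto Q j)}"

definition cells ::
  "(real ^ 'd \<Rightarrow> real) \<Rightarrow> (real ^ 'd) list \<Rightarrow> (real ^ 'd) list \<Rightarrow> (real \<times> real) set set" where
  "cells N P Q =
     {cell N P Q i j | i j. 1 \<le> i \<and> i \<le> length P - 1 \<and> 1 \<le> j \<and> j \<le> length Q - 1}"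

definition norm1 :: "real \<times> real \<Rightarrow> real" where
  "norm1 x = \<bar>fst x\<bar> + \<bar>snd x\<bar>"

text \<open>
  The order on \<open>real \<times> real\<close> is the componentwise one. Continuity together with the
  existence of the finite exceptional set \<open>S\<close> is \<open>\<gamma> piecewise_C1_differentiable_on _\<close>; it is
  written out because the speed condition refers to the same \<open>S\<close>.
\<close>

definition is_path ::
  "(real ^ 'd \<Rightarrow> real) \<Rightarrow> (real ^ 'd) list \<Rightarrow> (real ^ 'd) list \<Rightarrow>
   real \<times> real \<Rightarrow> real \<times> real \<Rightarrow> (real \<Rightarrow> real \<times> real) \<Rightarrow> bool" where
  "is_path N P Q x y \<gamma> \<longleftrightarrow>
     \<gamma> ` {norm1 x..norm1 y} \<subseteq> param_space N P Q \<and>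
     \<gamma> (norm1 x) = x \<and> \<gamma> (norm1 y) = y \<and>
     mono_on {norm1 x..norm1 y} \<gamma> \<and>
     continuous_on {norm1 x..norm1 y} \<gamma> \<and>
     (\<exists>S. finite S \<and> \<gamma> C1_differentiable_on ({norm1 x..norm1 y} - S) \<and>
          (\<forall>t \<in> {norm1 x..norm1 y} - S. norm1 (vector_derivative \<gamma> (at t)) = 1))"

text \<open>The path \<open>\<gamma>\<close> runs along the segment from \<open>x\<close> to \<open>z\<close> and then along the one from \<open>z\<close> to \<open>y\<close>.\<close>

definition traces ::
  "(real \<Rightarrow> real \<times> real) \<Rightarrow> real \<times> real \<Rightarrow> real \<times> real \<Rightarrow> real \<times> real \<Rightarrow> bool" where
  "traces \<gamma> x z y \<longleftrightarrow>
     (\<exists>s \<in> {norm1 x..norm1 y}.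
        \<gamma> ` {norm1 x..s} = closed_segment x z \<and> \<gamma> ` {s..norm1 y} = closed_segment z y)"

definition path_cost ::
  "(real ^ 'd \<Rightarrow> real) \<Rightarrow> (real ^ 'd) list \<Rightarrow> (real ^ 'd) list \<Rightarrow>
   real \<times> real \<Rightarrow> real \<times> real \<Rightarrow> (real \<Rightarrow> real \<times> real) \<Rightarrow> real" where
  "path_cost N P Q x y \<gamma> =
     integral {norm1 x..norm1 y}
       (\<lambda>t. N (arc_param N P (fst (\<gamma> t)) - arc_param N Q (snd (\<gamma> t))))"


lemma arc_length_Cons_Cons:
  "arc_length N (p # q # ps) = N (q - p) + arc_length N (q # ps)"
proof -
  have "arc_length N (p # q # ps) =
      N (q - p) + (\<Sum>i = Suc 1..<Suc (length (q # ps)). N ((p # q # ps) ! i - (p # q # ps) ! (i - 1)))"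
    unfolding arc_length_def by (subst sum.atLeast_Suc_lessThan) auto
  also have "(\<Sum>i = Suc 1..<Suc (length (q # ps)). N ((p # q # ps) ! i - (p # q # ps) ! (i - 1)))
      = arc_length N (q # ps)"
    unfolding arc_length_def sum.shift_bounds_Suc_ivl
    by (intro sum.cong) (auto simp: nth_Cons')
  finally show ?thesis .
qed

lemma arc_length_nonneg: "is_norm N \<Longrightarrow> 0 \<le> arc_length N P"
  unfolding arc_length_def is_norm_def by (auto intro: sum_nonneg)

lemma arc_param_0: "is_norm N \<Longrightarrow> arc_param N (p # ps) 0 = p"
  by (cases ps) (auto simp: is_norm_def)

lemma arc_param_shift:
  assumes "is_norm N" "p \<noteq> q" "N (q - p) \<le> t"
  shows "arc_param N (p # q # ps) t = arc_param N (q # ps) (t - N (q - p))"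
proof (cases "t = N (q - p)")
  case True
  have "N (q - p) \<noteq> 0"
    using assms(1,2) by (auto simp: is_norm_def)
  then show ?thesis
    using True arc_param_0[OF assms(1)] by simp
next
  case False
  then show ?thesis
    using assms(3) by simp
qed

lemma arc_param_edge:
  assumes "is_norm N" "distinct_adj P" "1 \<le> i" "i \<le> length P - 1"
    and "arc_length N (curve_upto P (i - 1)) \<le> t" "t \<le> arc_length N (curve_upto P i)"
  shows "arc_param N P t =
    P ! (i - 1) + ((t - arc_length N (curve_upto P (i - 1))) / N (P ! i - P ! (i - 1))) *\<^sub>R
      (P ! i - P ! (i - 1))"
  using assms(2-)
proof (induction P arbitrary: i t)
  case (Cons p ps)
  then obtain q qs where ps: "ps = q # qs"
    by (cases ps) auto
  show ?case
  proof (cases "i = 1")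
    case True
    have "arc_length N (take 1 (p # ps)) = 0" "arc_length N (take 2 (p # ps)) = N (q - p)"
      by (auto simp: ps arc_length_def numeral_2_eq_2)
    then show ?thesis
      using Cons.prems True by (simp add: ps numeral_2_eq_2)
  next
    case False
    then have "i = Suc (Suc (i - 2))"
      using Cons.prems(2) by simp
    then obtain k where k: "i = Suc (Suc k)" ..
    have 1: "arc_length N (curve_upto (p # ps) (Suc k)) = N (q - p) + arc_length N (curve_upto ps k)"
      and 2: "arc_length N (curve_upto (p # ps) i) = N (q - p) + arc_length N (curve_upto ps (Suc k))"
      by (simp_all add: ps k arc_length_Cons_Cons)
    have "N (q - p) \<le> t"
      using Cons.prems(4) 1 arc_length_nonneg[OF assms(1), of "curve_upto ps k"] by (simp add: k)
    then have "arc_param N (p # ps) t = arc_param N ps (t - N (q - p))"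
      using Cons.prems(1) arc_param_shift[OF assms(1)] by (auto simp only: ps distinct_adj_Cons_Cons)
    also have "\<dots> = ps ! (Suc k - 1) +
        ((t - N (q - p) - arc_length N (curve_upto ps (Suc k - 1))) / N (ps ! Suc k - ps ! (Suc k - 1))) *\<^sub>R
          (ps ! Suc k - ps ! (Suc k - 1))"
      using Cons.prems 1 2 by (intro Cons.IH) (auto simp: k ps)
    finally show ?thesis
      using 1 by (simp add: k algebra_simps)
  qed
qed simp

text \<open>
  A statement about all paths tracing \<open>x\<close>, \<open>z\<close>, \<open>y\<close> is not vacuous: for both corners \<open>z\<close> of the
  rectangle spanned by \<open>x \<le> y\<close> such a path exists.
\<close>

lemma traces_path_exists_aux:
  fixes u v :: "real \<times> real"
  assumes "0 \<le> x" "y \<le> (a, b)" "x \<le> y"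
    and uv: "0 \<le> u" "0 \<le> v" "norm1 u = 1" "norm1 v = 1"
    and a': "norm1 x \<le> s" "s \<le> norm1 y"
    and z: "z = x + (s - norm1 x) *\<^sub>R u" and y: "y = z + (norm1 y - s) *\<^sub>R v"
    and "a = arc_length N P" "b = arc_length N Q"
  shows "\<exists>\<gamma>. is_path N P Q x y \<gamma> \<and> traces \<gamma> x z y"
proof -
  define \<gamma> where "\<gamma> = (\<lambda>t. if t \<le> s then x + (t - norm1 x) *\<^sub>R u else z + (t - s) *\<^sub>R v)"
  have \<gamma>1: "\<gamma> t = x + (t - norm1 x) *\<^sub>R u" if "t \<le> s" for t
    using that by (simp add: \<gamma>_def)
  have \<gamma>2: "\<gamma> t = z + (t - s) *\<^sub>R v" if "s \<le> t" for t
    using that z by (auto simp: \<gamma>_def)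
  have cont: "continuous_on {norm1 x..norm1 y} \<gamma>"
  proof -
    have "continuous_on ({norm1 x..s} \<union> {s..norm1 y}) \<gamma>"
      unfolding \<gamma>_def
      by (rule continuous_on_cases) (auto intro!: continuous_intros simp: z)
    then show ?thesis
      using a' by (simp add: ivl_disj_un_two_touch)
  qed
  have mono: "mono_on {norm1 x..norm1 y} \<gamma>"
  proof (rule mono_onI)
    fix r t assume "r \<in> {norm1 x..norm1 y}" "t \<in> {norm1 x..norm1 y}" "r \<le> t"
    have m1: "\<gamma> r \<le> \<gamma> t" if "r \<le> t" "t \<le> s" for r t
      using that uv(1) by (auto simp: \<gamma>1 less_eq_prod_def mult_right_mono)
    have m2: "\<gamma> r \<le> \<gamma> t" if "r \<le> t" "s \<le> r" for r t
      using that uv(2) by (auto simp: \<gamma>2 less_eq_prod_def mult_right_mono)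
    show "\<gamma> r \<le> \<gamma> t"
      using m1[of r t] m2[of r t] m1[of r s] m2[of s t] \<open>r \<le> t\<close> by (meson linear order_trans)
  qed
  have ends: "\<gamma> (norm1 x) = x" "\<gamma> (norm1 y) = y"
    using a' \<gamma>1[of "norm1 x"] \<gamma>2[of "norm1 y"] y by auto
  have range: "\<gamma> ` {norm1 x..norm1 y} \<subseteq> param_space N P Q"
  proof (rule image_subsetI)
    fix t assume t: "t \<in> {norm1 x..norm1 y}"
    then have "\<gamma> (norm1 x) \<le> \<gamma> t" "\<gamma> t \<le> \<gamma> (norm1 y)"
      using a' by (auto intro!: mono_onD[OF mono])
    then have "0 \<le> \<gamma> t" "\<gamma> t \<le> (a, b)"
      using assms(1,2) ends order_trans by metis+
    then show "\<gamma> t \<in> param_space N P Q"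
      using assms(12,13) by (cases "\<gamma> t") (auto simp: param_space_def less_eq_prod_def)
  qed
  have d1: "(\<gamma> has_vector_derivative u) (at t)" if "t < s" for t
  proof -
    have "((\<lambda>t. x + (t - norm1 x) *\<^sub>R u) has_vector_derivative u) (at t)"
      by (auto intro!: derivative_eq_intros)
    then show ?thesis
      by (rule has_vector_derivative_transform_within_open[where S = "{..<s}"]) (use that in \<open>auto simp: \<gamma>1\<close>)
  qed
  have d2: "(\<gamma> has_vector_derivative v) (at t)" if "s < t" for t
  proof -
    have "((\<lambda>t. z + (t - s) *\<^sub>R v) has_vector_derivative v) (at t)"
      by (auto intro!: derivative_eq_intros)
    then show ?thesis
      by (rule has_vector_derivative_transform_within_open[where S = "{s<..}"]) (use that in \<open>auto simp: \<gamma>2\<close>)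
  qed
  have c1: "\<gamma> C1_differentiable_on ({norm1 x..norm1 y} - {s})"
    unfolding C1_differentiable_on_def
  proof (intro exI conjI ballI)
    show "(\<gamma> has_vector_derivative (if t < s then u else v)) (at t)"
      if "t \<in> {norm1 x..norm1 y} - {s}" for t
      using that d1 d2 by auto
    have "continuous_on ({..<s} \<union> {s<..}) (\<lambda>t. if t < s then u else v)"
      by (rule continuous_on_open_Un)
         (auto cong: continuous_on_cong simp: continuous_on_const intro: continuous_on_eq[OF continuous_on_const])
    then show "continuous_on ({norm1 x..norm1 y} - {s}) (\<lambda>t. if t < s then u else v)"
      by (rule continuous_on_subset) auto
  qed
  have speed: "norm1 (vector_derivative \<gamma> (at t)) = 1" if "t \<noteq> s" for t
    using that d1[of t] d2[of t] uv by (cases "t < s") (auto simp: vector_derivative_at)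
  have image: "(\<lambda>t. w + (t - c) *\<^sub>R e) ` {c..d} = closed_segment w (w + (d - c) *\<^sub>R e)"
    if "c \<le> d" for w e :: "real \<times> real" and c d
  proof -
    have "(\<lambda>t. w + (t - c) *\<^sub>R e) ` {c..d} = (\<lambda>t. (w - c *\<^sub>R e) + t *\<^sub>R e) ` closed_segment c d"
      using that by (simp add: closed_segment_eq_real_ivl algebra_simps)
    also have "\<dots> = (+) (w - c *\<^sub>R e) ` (\<lambda>t. t *\<^sub>R e) ` closed_segment c d"
      by (simp add: image_image)
    also have "(\<lambda>t. t *\<^sub>R e) ` closed_segment c d = closed_segment (c *\<^sub>R e) (d *\<^sub>R e)"
      by (rule closed_segment_linear_image[symmetric]) (simp add: linear_iff scaleR_left_distrib)
    also have "(+) (w - c *\<^sub>R e) ` \<dots> = closed_segment w (w + (d - c) *\<^sub>R e)"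
      by (simp only: closed_segment_translation [symmetric]) (simp add: algebra_simps)
    finally show ?thesis .
  qed
  have "\<gamma> ` {norm1 x..s} = closed_segment x z"
    using image[OF a'(1), of x u] z by (simp add: \<gamma>1)
  moreover have "\<gamma> ` {s..norm1 y} = closed_segment z y"
    using image[OF a'(2), of z v] y by (simp add: \<gamma>2)
  ultimately have "traces \<gamma> x z y"
    unfolding traces_def using a' by (intro bexI[of _ s] conjI) simp_all
  moreover have "is_path N P Q x y \<gamma>"
    unfolding is_path_def using range ends mono cont c1 speed
    by (auto intro!: exI[of _ "{s}"])
  ultimately show ?thesis
    by blast
qed

lemma traces_path_exists:
  assumes "x \<in> param_space N P Q" "y \<in> param_space N P Q" "x \<le> y"
    and z: "z = (fst x, snd y) \<or> z = (fst y, snd x)"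
  shows "\<exists>\<gamma>. is_path N P Q x y \<gamma> \<and> traces \<gamma> x z y"
proof -
  have le: "0 \<le> x" "y \<le> (arc_length N P, arc_length N Q)"
    using assms(1,2) by (auto simp: param_space_def less_eq_prod_def)
  then have n: "norm1 x = fst x + snd x" "norm1 y = fst y + snd y"
    using assms(3) by (auto simp: norm1_def less_eq_prod_def)
  from z show ?thesis
  proof
    assume "z = (fst x, snd y)"
    then show ?thesis
      using assms(3)
      by (intro traces_path_exists_aux[OF le assms(3), where u = "(0, 1)" and v = "(1, 0)" and s = "fst x + snd y"])
         (auto simp: n less_eq_prod_def prod_eq_iff, auto simp: norm1_def)
  next
    assume "z = (fst y, snd x)"
    then show ?thesis
      using assms(3)
      by (intro traces_path_exists_aux[OF le assms(3), where u = "(1, 0)" and v = "(0, 1)" and s = "fst y + snd x"])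
         (auto simp: n less_eq_prod_def prod_eq_iff, auto simp: norm1_def)
  qed
qed

end

theory Submission
  imports Defs
begin

text \<open>
  Inside a cell, \<open>F s t = N (P s - Q t)\<close> compares two unit speed lines, so the triangle inequality
  gives \<open>\<bar>s - s'\<bar> - F s' t \<le> F s t \<le> F s' t + \<bar>s - s'\<bar>\<close> and likewise in \<open>t\<close>. For the rectangle with
  sides \<open>\<alpha>\<close> and \<open>\<beta>\<close> spanned by \<open>x\<close> and \<open>y\<close>, the upper bound moves each side of one path to the
  opposite side of the rectangle, so the two costs differ by at most \<open>2\<alpha>\<beta>\<close>. Pairing points half a
  side apart in the lower bound shows that either path costs at least \<open>(\<alpha>\<^sup>2 + \<beta>\<^sup>2) / 4 \<ge> \<alpha>\<beta> / 2\<close>.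
  Hence one cost is at most \<open>1 + 4\<close> times the other.
\<close>

section \<open>Integral bounds on the sides of a rectangle\<close>

text \<open>With \<open>c\<close> half the length, \<open>pair\<close> at \<open>t\<close> and
  \<open>t + c\<close> gives \<open>c \<le> h t + h (t + c)\<close>. Integrating this over the left
  half, itself of length \<open>c\<close>, yields the bound \<open>c * c\<close>.\<close>

lemma integral_ge_of_pairing:
  fixes h :: "real \<Rightarrow> real"
  assumes "a \<le> b" and h: "h integrable_on {a..b}"
    and pair: "\<And>s t. s \<in> {a..b} \<Longrightarrow> t \<in> {a..b} \<Longrightarrow> \<bar>s - t\<bar> \<le> h s + h t"
  shows "(b - a)\<^sup>2 / 4 \<le> integral {a..b} h"
proof -
  define c where "c = (b - a) / 2"
  have c: "0 \<le> c" "b = a + c + c"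
    using \<open>a \<le> b\<close> by (auto simp: c_def field_simps)
  have h1: "h integrable_on {a..a + c}" and h2: "h integrable_on {a + c..a + c + c}"
    using c by (auto intro: integrable_on_subinterval[OF h])
  have h2': "(h \<circ> (+) c) integrable_on {a..a + c}"
    using h2 unfolding integrable_on_def has_integral_shift_Icc_real by blast
  have "c * c = integral {a..a + c} (\<lambda>_. c)"
    using c by simp
  also have "\<dots> \<le> integral {a..a + c} (\<lambda>t. h t + (h \<circ> (+) c) t)"
  proof (intro integral_le integrable_add h1 h2')
    show "c \<le> h t + (h \<circ> (+) c) t" if "t \<in> {a..a + c}" for t
      using pair[of t "c + t"] that c by auto
  qed auto
  also have "\<dots> = integral {a..a + c} h + integral {a..a + c} (h \<circ> (+) c)"
    by (rule integral_add[OF h1 h2'])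
  \<comment> \<open>Translation by \<open>c\<close> carries the left half onto the right half, so
    the two integrals recombine to the full one.\<close>
  also have "integral {a..a + c} (h \<circ> (+) c) = integral {a + c..b} h"
    by (simp only: integral_shift_Icc_real c(2))
  also have "integral {a..a + c} h + integral {a + c..b} h = integral {a..b} h"
    using c h by (intro Henstock_Kurzweil_Integration.integral_combine) auto
  finally show ?thesis
    by (simp add: c_def power2_eq_square)
qed

lemma integral_le_integral_add_const:
  fixes f g :: "real \<Rightarrow> real"
  assumes "a \<le> b" "f integrable_on {a..b}" "g integrable_on {a..b}"
    and "\<And>t. t \<in> {a..b} \<Longrightarrow> f t \<le> g t + c"
  shows "integral {a..b} f \<le> integral {a..b} g + (b - a) * c"
proof -
  have "integral {a..b} f \<le> integral {a..b} (\<lambda>t. g t + c)"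
    using assms by (intro integral_le integrable_add) auto
  also have "\<dots> = integral {a..b} g + (b - a) * c"
    using assms by (subst integral_add) auto
  finally show ?thesis .
qed

lemma abs_le_imp_integrable:
  fixes h :: "real \<Rightarrow> real"
  assumes "\<And>s t. s \<in> {a..b} \<Longrightarrow> t \<in> {a..b} \<Longrightarrow> \<bar>h s - h t\<bar> \<le> \<bar>s - t\<bar>"
  shows "h integrable_on {a..b}"
proof -
  have "1-lipschitz_on {a..b} h"
    using assms by (intro lipschitz_onI) (auto simp: dist_real_def)
  then show ?thesis
    by (intro integrable_continuous_interval lipschitz_on_continuous_on)
qed

text \<open>The values \<open>p\<close>, \<open>q\<close> select the sides used by one path,
  \<open>p'\<close>, \<open>q'\<close> those used by the other. Keeping them arbitrary lets one
  statement serve both directions of the comparison.\<close>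

lemma opposite_sides_integral_le:
  fixes F :: "real \<Rightarrow> real \<Rightarrow> real"
  assumes "a \<le> b" "c \<le> d"
    and lip1: "\<And>s s' t. s \<in> {a..b} \<Longrightarrow> s' \<in> {a..b} \<Longrightarrow> t \<in> {c..d} \<Longrightarrow> \<bar>F s t - F s' t\<bar> \<le> \<bar>s - s'\<bar>"
    and lip2: "\<And>s t t'. s \<in> {a..b} \<Longrightarrow> t \<in> {c..d} \<Longrightarrow> t' \<in> {c..d} \<Longrightarrow> \<bar>F s t - F s t'\<bar> \<le> \<bar>t - t'\<bar>"
    and pair1: "\<And>s s' t. s \<in> {a..b} \<Longrightarrow> s' \<in> {a..b} \<Longrightarrow> t \<in> {c..d} \<Longrightarrow> \<bar>s - s'\<bar> \<le> F s t + F s' t"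
    and pair2: "\<And>s t t'. s \<in> {a..b} \<Longrightarrow> t \<in> {c..d} \<Longrightarrow> t' \<in> {c..d} \<Longrightarrow> \<bar>t - t'\<bar> \<le> F s t + F s t'"
    and p: "p \<in> {a..b}" "p' \<in> {a..b}" and q: "q \<in> {c..d}" "q' \<in> {c..d}"
  shows "integral {a..b} (\<lambda>s. F s q) + integral {c..d} (F p) \<le>
    5 * (integral {a..b} (\<lambda>s. F s q') + integral {c..d} (F p'))"
proof -
  let ?\<alpha> = "b - a" and ?\<beta> = "d - c"
  have int1: "(\<lambda>s. F s t) integrable_on {a..b}" if "t \<in> {c..d}" for t
    using that lip1 by (intro abs_le_imp_integrable) auto
  have int2: "F s integrable_on {c..d}" if "s \<in> {a..b}" for s
    using that lip2 by (intro abs_le_imp_integrable) auto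
  have "integral {a..b} (\<lambda>s. F s q) \<le> integral {a..b} (\<lambda>s. F s q') + ?\<alpha> * ?\<beta>"
  proof (rule integral_le_integral_add_const)
    show "F s q \<le> F s q' + ?\<beta>" if "s \<in> {a..b}" for s
      using lip2[OF that q] q by auto
  qed (use assms int1 in auto)
  moreover have "integral {c..d} (F p) \<le> integral {c..d} (F p') + ?\<beta> * ?\<alpha>"
  proof (rule integral_le_integral_add_const)
    show "F p t \<le> F p' t + ?\<alpha>" if "t \<in> {c..d}" for t
      using lip1[OF p that] p by auto
  qed (use assms int2 in auto)
  moreover have "?\<alpha>\<^sup>2 / 4 \<le> integral {a..b} (\<lambda>s. F s q')"
    using assms int1 by (intro integral_ge_of_pairing) auto
  moreover have "?\<beta>\<^sup>2 / 4 \<le> integral {c..d} (F p')"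
    using assms int2 by (intro integral_ge_of_pairing) auto
  \<comment> \<open>So the two quarter-square bounds total at least half of
    \<open>?\<alpha> * ?\<beta>\<close>, and four times the right-hand sum absorbs both transfer
    errors.\<close>
  moreover have "2 * (?\<alpha> * ?\<beta>) \<le> ?\<alpha>\<^sup>2 + ?\<beta>\<^sup>2"
    using sum_squares_bound[of ?\<alpha> ?\<beta>] by (simp only: mult.assoc)
  ultimately show ?thesis
    by (simp add: mult.commute[of ?\<beta>])
qed

section \<open>Distances between points of one edge\<close>

lemma norm_sub_triangle:
  assumes "is_norm N"
  shows "N (u - w) \<le> N (u - v) + N (v - w)"
proof -
  have "N ((u - v) + (v - w)) \<le> N (u - v) + N (v - w)"
    using assms unfolding is_norm_def by blast
  then show ?thesis by simp
qed

lemma norm_sub_commute: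
  assumes "is_norm N"
  shows "N (u - v) = N (v - u)"
proof -
  have "N ((-1) *\<^sub>R (v - u)) = \<bar>-1\<bar> * N (v - u)"
    using assms unfolding is_norm_def by blast
  then show ?thesis by simp
qed

text \<open>Both parameters lie on one edge, so the points differ by \<open>(s - t) / N e\<close>
  times the edge vector \<open>e\<close>. Consecutive vertices are distinct, hence
  \<open>N e\<close> is nonzero and cancels.\<close>

lemma norm_arc_param_diff:
  assumes N: "is_norm N" and P: "polygonal_curve P" and i: "1 \<le> i" "i \<le> length P - 1"
    and s: "s \<in> {arc_length N (curve_upto P (i - 1))..arc_length N (curve_upto P i)}"
    and t: "t \<in> {arc_length N (curve_upto P (i - 1))..arc_length N (curve_upto P i)}"
  shows "N (arc_param N P s - arc_param N P t) = \<bar>s - t\<bar>"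
proof -
  define e where "e = P ! i - P ! (i - 1)"
  have adj: "distinct_adj P"
    using P by (simp add: polygonal_curve_def)
  have "P ! (i - 1) \<noteq> P ! Suc (i - 1)"
    using adj i by (intro distinct_adj_nth) auto
  then have "N e \<noteq> 0"
    using N i by (auto simp: e_def is_norm_def)
  have "arc_param N P s - arc_param N P t = ((s - t) / N e) *\<^sub>R e"
    using s t by (simp add: arc_param_edge[OF N adj i] e_def diff_divide_distrib algebra_simps)
  also have "N \<dots> = \<bar>(s - t) / N e\<bar> * N e"
    using N unfolding is_norm_def by blast
  also have "\<dots> = \<bar>s - t\<bar>"
    using \<open>N e \<noteq> 0\<close> N by (simp add: is_norm_def)
  finally show ?thesis .
qed

section \<open>Coordinates of a path and integration along its legs\<close>

text \<open>
  Monotonicity makes both coordinates of \<open>\<gamma>'\<close> nonnegative, so \<open>\<parallel>\<gamma>'\<parallel>\<^sub>1 = 1\<close> says that the sum of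
  the coordinates of \<open>\<gamma>\<close> has derivative \<open>1\<close>.
\<close>

lemma is_path_coordinate_sum:
  assumes path: "is_path N P Q x y \<gamma>" and "0 \<le> x" and t: "t \<in> {norm1 x..norm1 y}"
  shows "fst (\<gamma> t) + snd (\<gamma> t) = t"
proof -
  let ?I = "{norm1 x..norm1 y}"
  obtain S where S: "finite S" "\<gamma> C1_differentiable_on (?I - S)"
    and speed: "\<And>t. t \<in> ?I - S \<Longrightarrow> norm1 (vector_derivative \<gamma> (at t)) = 1"
    using path unfolding is_path_def by blast
  have mono: "mono_on ?I \<gamma>" and cont: "continuous_on ?I \<gamma>" and start: "\<gamma> (norm1 x) = x"
    using path by (auto simp: is_path_def)
  have "fst (\<gamma> t) + snd (\<gamma> t) - t = 0"
  proof (rule has_derivative_zero_unique_strong_interval[where f = "\<lambda>t. fst (\<gamma> t) + snd (\<gamma> t) - t"])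
    \<comment> \<open>Adding the endpoints to the exceptional set leaves only interior points, where
      monotonicity determines the sign of a derivative.\<close>
    show "finite (S \<union> {norm1 x, norm1 y})"
      using S by simp
    show "continuous_on ?I (\<lambda>t. fst (\<gamma> t) + snd (\<gamma> t) - t)"
      by (intro continuous_intros cont)
    \<comment> \<open>Here \<open>0 \<le> x\<close> removes the absolute values in
      \<open>norm1 x\<close>.\<close>
    show "fst (\<gamma> (norm1 x)) + snd (\<gamma> (norm1 x)) - norm1 x = 0"
      using \<open>0 \<le> x\<close> start by (simp add: norm1_def less_eq_prod_def)
    fix r assume r: "r \<in> ?I - (S \<union> {norm1 x, norm1 y})"
    then have int: "r \<in> interior ?I"
      by auto
    define D where "D = vector_derivative \<gamma> (at r)"
    have "\<gamma> differentiable at r"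
      using S(2) r by (auto simp: C1_differentiable_on_eq)
    then have D: "(\<gamma> has_vector_derivative D) (at r)"
      by (simp add: D_def vector_derivative_works)
    have d1: "((\<lambda>t. fst (\<gamma> t)) has_real_derivative fst D) (at r)"
      and d2: "((\<lambda>t. snd (\<gamma> t)) has_real_derivative snd D) (at r)"
      using bounded_linear.has_vector_derivative[OF bounded_linear_fst D]
        bounded_linear.has_vector_derivative[OF bounded_linear_snd D]
      by (simp_all add: has_real_derivative_iff_has_vector_derivative)
    have "mono_on ?I (\<lambda>t. fst (\<gamma> t))" "mono_on ?I (\<lambda>t. snd (\<gamma> t))"
      using mono by (auto simp: mono_on_def less_eq_prod_def)
    then have "0 \<le> fst D" "0 \<le> snd D"
      by (auto intro: mono_on_imp_deriv_nonneg[OF _ d1 int] mono_on_imp_deriv_nonneg[OF _ d2 int])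
    moreover have "norm1 D = 1"
      using speed r by (simp add: D_def)
    ultimately have "fst D + snd D - 1 = 0"
      by (simp add: norm1_def)
    moreover have "((\<lambda>t. fst (\<gamma> t) + snd (\<gamma> t) - t) has_real_derivative fst D + snd D - 1) (at r)"
      by (intro derivative_intros d1 d2)
    ultimately have "((\<lambda>t. fst (\<gamma> t) + snd (\<gamma> t) - t) has_real_derivative 0) (at r)"
      by simp
    then show "((\<lambda>t. fst (\<gamma> t) + snd (\<gamma> t) - t) has_derivative (\<lambda>h. 0)) (at r within ?I)"
      unfolding has_field_derivative_def lambda_zero[symmetric] by (rule has_derivative_at_withinI)
  qed (rule t)
  then show ?thesis by simp
qed

lemma closed_segment_vertical:
  fixes p :: "real \<times> real"
  assumes "p \<in> closed_segment (a, b) (a, c)"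
  shows "fst p = a"
  using assms by (auto simp: closed_segment_def algebra_simps)

lemma closed_segment_horizontal:
  fixes p :: "real \<times> real"
  assumes "p \<in> closed_segment (a, b) (c, b)"
  shows "snd p = b"
  using assms by (auto simp: closed_segment_def algebra_simps)

text \<open>Each leg of a path is a side of the rectangle translated in time: \<open>u\<close> and
  \<open>v\<close> are the two time shifts, and \<open>m\<close> is the moment at which the legs
  meet.\<close>

lemma has_integral_two_pieces:
  fixes f g h :: "real \<Rightarrow> real"
  assumes "a \<le> b" "c \<le> d" "a + u = l" "b + u = m" "c + v = m" "d + v = r"
    and "g integrable_on {a..b}" "h integrable_on {c..d}"
    and g: "\<And>t. t \<in> {l..m} \<Longrightarrow> f t = g (t - u)"
    and h: "\<And>t. t \<in> {m..r} \<Longrightarrow> f t = h (t - v)"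
  shows "(f has_integral integral {a..b} g + integral {c..d} h) {l..r}"
proof (rule has_integral_combine)
  have "(f \<circ> (+) u has_integral integral {a..b} g) {a..b}"
    using integrable_integral[OF assms(7)]
    by (rule has_integral_eq[rotated]) (use assms in auto)
  then show "(f has_integral integral {a..b} g) {l..m}"
    using assms by (simp add: has_integral_shift_Icc_real)
  have "(f \<circ> (+) v has_integral integral {c..d} h) {c..d}"
    using integrable_integral[OF assms(8)]
    by (rule has_integral_eq[rotated]) (use assms in auto)
  then show "(f has_integral integral {c..d} h) {m..r}"
    using assms by (simp add: has_integral_shift_Icc_real)
qed (use assms in auto)

section \<open>Path costs as integrals over two sides of the rectangle\<close>

context
  fixes N :: "real ^ 'd \<Rightarrow> real" and P Q :: "(real ^ 'd) list"
    and x y :: "real \<times> real" and \<gamma> :: "real \<Rightarrow> real \<times> real" and F :: "real \<Rightarrow> real \<Rightarrow> real"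
  assumes path: "is_path N P Q x y \<gamma>" and x0: "0 \<le> x" and xy: "x \<le> y"
    and int1: "\<And>t. t \<in> {snd x..snd y} \<Longrightarrow> (\<lambda>s. F s t) integrable_on {fst x..fst y}"
    and int2: "\<And>s. s \<in> {fst x..fst y} \<Longrightarrow> F s integrable_on {snd x..snd y}"
    and F: "\<And>s t. F s t = N (arc_param N P s - arc_param N Q t)"
begin

text \<open>On each leg one coordinate is constant and the coordinates sum to \<open>t\<close>, so
  the other is \<open>t\<close> minus that constant. The left and top sides appear.\<close>

lemma path_cost_vertical_first:
  assumes "traces \<gamma> x (fst x, snd y) y"
  shows "path_cost N P Q x y \<gamma> =
    integral {fst x..fst y} (\<lambda>s. F s (snd y)) + integral {snd x..snd y} (F (fst x))"
proof -
  have n: "norm1 x = fst x + snd x" "norm1 y = fst y + snd y" and le: "fst x \<le> fst y" "snd x \<le> snd y"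
    using x0 xy by (auto simp: norm1_def less_eq_prod_def)
  obtain m where m: "m \<in> {norm1 x..norm1 y}"
    and seg1: "\<gamma> ` {norm1 x..m} = closed_segment x (fst x, snd y)"
    and seg2: "\<gamma> ` {m..norm1 y} = closed_segment (fst x, snd y) y"
    using assms unfolding traces_def by blast
  have sum: "fst (\<gamma> t) + snd (\<gamma> t) = t" if "t \<in> {norm1 x..norm1 y}" for t
    using is_path_coordinate_sum[OF path x0 that] .
  have c1: "fst (\<gamma> t) = fst x" if "t \<in> {norm1 x..m}" for t
    using seg1 that by (intro closed_segment_vertical[where b = "snd x" and c = "snd y"]) auto
  have c2: "snd (\<gamma> t) = snd y" if "t \<in> {m..norm1 y}" for t
    using seg2 that by (intro closed_segment_horizontal[where a = "fst x" and c = "fst y"]) auto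
  \<comment> \<open>The time \<open>m\<close> belongs to both legs, so both coordinates of the
    corner are known there, and their sum is \<open>m\<close>.\<close>
  have m_eq: "m = fst x + snd y"
    using sum[OF m] c1[of m] c2[of m] m by simp
  \<comment> \<open>The summands follow the order in time here; the conclusion lists the horizontal
    side first for both kinds of path.\<close>
  have "((\<lambda>t. F (fst (\<gamma> t)) (snd (\<gamma> t))) has_integral
      integral {snd x..snd y} (F (fst x)) + integral {fst x..fst y} (\<lambda>s. F s (snd y)))
      {norm1 x..norm1 y}"
  proof (rule has_integral_two_pieces)
    show "F (fst (\<gamma> t)) (snd (\<gamma> t)) = F (fst x) (t - fst x)" if "t \<in> {norm1 x..m}" for t
    proof -
      have "snd (\<gamma> t) = t - fst x"
        using c1[OF that] sum[of t] that m by auto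
      then show ?thesis
        using c1[OF that] by simp
    qed
    show "F (fst (\<gamma> t)) (snd (\<gamma> t)) = F (t - snd y) (snd y)" if "t \<in> {m..norm1 y}" for t
    proof -
      have "fst (\<gamma> t) = t - snd y"
        using c2[OF that] sum[of t] that m by auto
      then show ?thesis
        using c2[OF that] by simp
    qed
  qed (use le n m_eq int1 int2 in auto)
  then show ?thesis
    unfolding path_cost_def F[symmetric] by (simp add: integral_unique)
qed

text \<open>The same argument with the coordinates exchanged; now the bottom and right sides
  appear.\<close>

lemma path_cost_horizontal_first:
  assumes "traces \<gamma> x (fst y, snd x) y"
  shows "path_cost N P Q x y \<gamma> =
    integral {fst x..fst y} (\<lambda>s. F s (snd x)) + integral {snd x..snd y} (F (fst y))"
proof -
  have n: "norm1 x = fst x + snd x" "norm1 y = fst y + snd y" and le: "fst x \<le> fst y" "snd x \<le> snd y"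
    using x0 xy by (auto simp: norm1_def less_eq_prod_def)
  obtain m where m: "m \<in> {norm1 x..norm1 y}"
    and seg1: "\<gamma> ` {norm1 x..m} = closed_segment x (fst y, snd x)"
    and seg2: "\<gamma> ` {m..norm1 y} = closed_segment (fst y, snd x) y"
    using assms unfolding traces_def by blast
  have sum: "fst (\<gamma> t) + snd (\<gamma> t) = t" if "t \<in> {norm1 x..norm1 y}" for t
    using is_path_coordinate_sum[OF path x0 that] .
  have c1: "snd (\<gamma> t) = snd x" if "t \<in> {norm1 x..m}" for t
    using seg1 that by (intro closed_segment_horizontal[where a = "fst x" and c = "fst y"]) auto
  have c2: "fst (\<gamma> t) = fst y" if "t \<in> {m..norm1 y}" for t
    using seg2 that by (intro closed_segment_vertical[where b = "snd x" and c = "snd y"]) auto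
  have m_eq: "m = fst y + snd x"
    using sum[OF m] c1[of m] c2[of m] m by simp
  have "((\<lambda>t. F (fst (\<gamma> t)) (snd (\<gamma> t))) has_integral
      integral {fst x..fst y} (\<lambda>s. F s (snd x)) + integral {snd x..snd y} (F (fst y)))
      {norm1 x..norm1 y}"
  proof (rule has_integral_two_pieces)
    show "F (fst (\<gamma> t)) (snd (\<gamma> t)) = F (t - snd x) (snd x)" if "t \<in> {norm1 x..m}" for t
    proof -
      have "fst (\<gamma> t) = t - snd x"
        using c1[OF that] sum[of t] that m by auto
      then show ?thesis
        using c1[OF that] by simp
    qed
    show "F (fst (\<gamma> t)) (snd (\<gamma> t)) = F (fst y) (t - fst y)" if "t \<in> {m..norm1 y}" for t
    proof -
      have "snd (\<gamma> t) = t - fst y"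
        using c2[OF that] sum[of t] that m by auto
      then show ?thesis
        using c2[OF that] by simp
    qed
  qed (use le n m_eq int1 int2 in auto)
  then show ?thesis
    unfolding path_cost_def F[symmetric] by (simp add: integral_unique)
qed

end

section \<open>Comparison of the two corner paths inside a cell\<close>

theorem lemma6:
  fixes N :: "real ^ 'd \<Rightarrow> real"
    and P Q :: "(real ^ 'd) list"
    and C :: "(real \<times> real) set"
    and x y :: "real \<times> real"
    and \<gamma>xy \<gamma>yx :: "real \<Rightarrow> real \<times> real"
  assumes "is_norm N"
    and "polygonal_curve P" and "polygonal_curve Q"
    and "C \<in> cells N P Q"
    and "x \<in> C" and "y \<in> C" and "x \<le> y"
    and "is_path N P Q x y \<gamma>xy" and "traces \<gamma>xy x (fst x, snd y) y"
    and "is_path N P Q x y \<gamma>yx" and "traces \<gamma>yx x (fst y, snd x) y"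
  shows "1 / 5 * path_cost N P Q x y \<gamma>xy \<le> path_cost N P Q x y \<gamma>yx \<and>
         path_cost N P Q x y \<gamma>yx \<le> 5 * path_cost N P Q x y \<gamma>xy"
proof -
  note N = \<open>is_norm N\<close>
  let ?p = "arc_param N P" and ?q = "arc_param N Q"
  let ?S = "{fst x..fst y}" and ?T = "{snd x..snd y}"
  define F where "F = (\<lambda>s t. N (?p s - ?q t))"
  obtain i j where C: "C = cell N P Q i j"
    and i: "1 \<le> i" "i \<le> length P - 1" and j: "1 \<le> j" "j \<le> length Q - 1"
    using \<open>C \<in> cells N P Q\<close> unfolding cells_def by blast
  have x0: "0 \<le> x"
    using \<open>x \<in> C\<close> arc_length_nonneg[OF N, of "curve_upto P (i - 1)"]
      arc_length_nonneg[OF N, of "curve_upto Q (j - 1)"]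
    by (auto simp: C cell_def less_eq_prod_def)
  have le: "fst x \<le> fst y" "snd x \<le> snd y"
    using \<open>x \<le> y\<close> by (auto simp: less_eq_prod_def)
  have dp: "N (?p s - ?p s') = \<bar>s - s'\<bar>" if "s \<in> ?S" "s' \<in> ?S" for s s'
    using that \<open>x \<in> C\<close> \<open>y \<in> C\<close>
    by (intro norm_arc_param_diff[OF N \<open>polygonal_curve P\<close> i]) (auto simp: C cell_def)
  have dq: "N (?q t - ?q t') = \<bar>t - t'\<bar>" if "t \<in> ?T" "t' \<in> ?T" for t t'
    using that \<open>x \<in> C\<close> \<open>y \<in> C\<close>
    by (intro norm_arc_param_diff[OF N \<open>polygonal_curve Q\<close> j]) (auto simp: C cell_def)
  \<comment> \<open>The third point given to \<open>norm_sub_triangle\<close> is the intermediate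
    one. Passing through a point of \<open>P\<close> gives \<open>lip1\<close>, passing through
    \<open>?q t\<close> gives \<open>pair1\<close>.\<close>
  have lip1: "\<bar>F s t - F s' t\<bar> \<le> \<bar>s - s'\<bar>" and pair1: "\<bar>s - s'\<bar> \<le> F s t + F s' t"
    if "s \<in> ?S" "s' \<in> ?S" for s s' t
    using norm_sub_triangle[OF N, of "?p s" "?q t" "?p s'"] norm_sub_triangle[OF N, of "?p s'" "?q t" "?p s"]
      norm_sub_triangle[OF N, of "?p s" "?p s'" "?q t"] norm_sub_commute[OF N, of "?p s'" "?q t"]
      dp[OF that] dp[OF that(2,1)]
    by (auto simp: F_def)
  have lip2: "\<bar>F s t - F s t'\<bar> \<le> \<bar>t - t'\<bar>" and pair2: "\<bar>t - t'\<bar> \<le> F s t + F s t'"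
    if "t \<in> ?T" "t' \<in> ?T" for s t t'
    using norm_sub_triangle[OF N, of "?p s" "?q t" "?q t'"] norm_sub_triangle[OF N, of "?p s" "?q t'" "?q t"]
      norm_sub_triangle[OF N, of "?q t" "?q t'" "?p s"] norm_sub_commute[OF N, of "?q t" "?p s"]
      dq[OF that] dq[OF that(2,1)]
    by (auto simp: F_def)
  have int1: "(\<lambda>s. F s t) integrable_on ?S" for t
    using lip1 by (intro abs_le_imp_integrable) auto
  have int2: "F s integrable_on ?T" for s
    using lip2 by (intro abs_le_imp_integrable) auto
  have cost_xy: "path_cost N P Q x y \<gamma>xy = integral ?S (\<lambda>s. F s (snd y)) + integral ?T (F (fst x))"
    by (rule path_cost_vertical_first) (use assms x0 int1 int2 in \<open>auto simp: F_def\<close>)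
  have cost_yx: "path_cost N P Q x y \<gamma>yx = integral ?S (\<lambda>s. F s (snd x)) + integral ?T (F (fst y))"
    by (rule path_cost_horizontal_first) (use assms x0 int1 int2 in \<open>auto simp: F_def\<close>)
  have opposite: "integral ?S (\<lambda>s. F s t) + integral ?T (F s) \<le>
      5 * (integral ?S (\<lambda>s. F s t') + integral ?T (F s'))"
    if "s \<in> ?S" "s' \<in> ?S" "t \<in> ?T" "t' \<in> ?T" for s s' t t'
    using le lip1 lip2 pair1 pair2 that by (intro opposite_sides_integral_le) auto
  \<comment> \<open>The first instance bounds the cost of \<open>\<gamma>xy\<close> by five times
    that of \<open>\<gamma>yx\<close>, the second does the converse.\<close>
  show ?thesis
    using opposite[of "fst x" "fst y" "snd y" "snd x"] opposite[of "fst y" "fst x" "snd x" "snd y"] le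
    by (simp add: cost_xy cost_yx)
qed

end
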